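(* For every integer $N\ge 0$ the families $S_{2N+1}(\lambda+n-1-(2N+1))$ and $D_{2N+1}^{\mathrm{nc}}(\lambda)$ of operators $C^\infty(\mathbb{R}^n)\to C^\infty(\mathbb{R}^{n-1})$ coincide, up to a rational function in $\lambda$; that is, there is a nonzero rational function $r_N(\lambda)$ such that $S_{2N+1}(\lambda+n-1-(2N+1))=r_N(\lambda)\,D_{2N+1}^{\mathrm{nc}}(\lambda)$ as rational families in $\lambda$.
   Context: Fix an integer $n\ge 4$. On $\mathbb{R}^n$ write $x=(x',x_n)$, let $(i^*\varphi)(x')=\varphi(x',0)$ and $\Delta_{\mathbb{M}^{n-1}}=-\frac{\partial^2}{\partial x_1^2}+\sum_{i=2}^{n-1}\frac{\partial^2}{\partial x_i^2}$. The family $S_{2N+1}$: let $\mathbb{U}_n=\{x\in\mathbb{R}^n: x_n>0\}$ with the Lorentzian metric $x_n^{-2}(-dx_1^2+\sum_{i=2}^n dx_i^2)$ and Laplacian $\Delta_{\mathbb{U}_n}=x_n^2\Delta_{\mathbb{M}^{n-1}}+x_n^2\frac{\partial^2}{\partial x_n^2}-(n-2)x_n\frac{\partial}{\partial x_n}$. Formal solutions $u\sim\sum_{j\ge0}x_n^{\lambda+2j}c_{2j}(x')$ of $-\Delta_{\mathbb{U}_n}u=\lambda(n-1-\lambda)u$ have their coefficients $c_{2j}$ determined recursively by $c_0$ (for generic $\lambda$); $T_{2j}(\lambda):C^\infty(\mathbb{R}^{n-1})\to C^\infty(\mathbb{R}^{n-1})$ is the resulting differential operator $c_0\mapsto c_{2j}$,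 with $T_0=\mathrm{id}$ (it depends rationally on $\lambda$). Define $S_{2N+1}(\lambda):C^\infty(\mathbb{R}^n)\to C^\infty(\mathbb{R}^{n-1})$ by $S_{2N+1}(\lambda)=\sum_{j=0}^N\frac{1}{(2N+1-2j)!}T_{2j}(\lambda)\,i^*\left(\frac{\partial}{\partial x_n}\right)^{2N+1-2j}$. The family $D_{2N+1}^{\mathrm{nc}}$: for $m\in\{n,n+1\}$ let $G^m=O(2,m-1)$ (preserving $-t_1^2-t_2^2+x_1^2+\dots+x_{m-1}^2$, coordinates ordered $(t_1,t_2,x_1,\dots)$), with Lie algebra $\mathfrak{g}_m$. With elementary matrices $E_{ab}$ put $H=E_{14}+E_{41}$, $H_2=E_{23}+E_{32}$, $Q_1^-=-E_{12}+E_{21}+E_{24}+E_{42}$, $Q_2^-=E_{13}+E_{31}+E_{34}-E_{43}$, and for $1\le i,j\le m-3$: $Y_j^-=E_{4+j,1}+E_{4+j,4}+E_{1,4+j}-E_{4,4+j}$, $Z_j^+=E_{2,4+j}+E_{3,4+j}+E_{4+j,2}-E_{4+j,3}$, $M_{ij}=E_{4+i,4+j}-E_{4+j,4+i}$; $Q_i^+,Y_j^+,Z_j^-$ are the transposes of $Q_i^-,Y_j^-,Z_j^+$. Let $A=\exp(\mathbb{R}H)$, $\mathfrak{n}_m^\pm=\mathrm{span}(Q_1^\pm,Q_2^\pm,Y_j^\pm)$ (abelian), $(N^\pm)^m=\exp\mathfrak{n}_m^\pm$, $M_0^m$ the analytic subgroup with Lie algebra $\mathfrak{m}_m=\mathrm{span}(H_2,Z_j^\pm,M_{ij})$,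 $w_1=\mathrm{diag}(1,-1,1,1,\dots,1)$, $w_2=\mathrm{diag}(1,1,-1,1,\dots,1)$, $\hat M^m=\langle w_1,w_2\rangle M_0^m$, $M^m=\{1,-1\}\hat M^m$, $P^m=M^mA(N^+)^m$, $\xi_\lambda(\exp tH)=e^{\lambda t}$, $\sigma_-$ the character of $M^m$ trivial on $\hat M^m$ with $\sigma_-(-1)=-1$. For a character $\sigma$ of $M^m$, $\mathrm{Ind}_{P^m}^{G^m}(\xi_\lambda\otimes\sigma)=\{u\in C^\infty(G^m): u(g\tilde m\tilde a\tilde n)=\sigma(\tilde m)\xi_\lambda(\tilde a)u(g)\ \forall\,\tilde m\tilde a\tilde n\in P^m\}$ ($\sigma$ omitted if trivial). $\mathcal{U}(\mathfrak{g}_{n+1})$ acts on $C^\infty(G^{n+1})$ by extending $(R(X)u)(x)=\frac{d}{dt}|_{t=0}u(x\exp tX)$. Embed $G^n\subset G^{n+1}$ by $g\mapsto\begin{pmatrix}g&0\\0&1\end{pmatrix}$. Let $\Delta_{n-1}=-(Q_1^-)^2+(Q_2^-)^2+\sum_{j=1}^{n-3}(Y_j^-)^2$, $T_n=Y_{n-2}^-\in\mathfrak{n}_{n+1}^-$, and $\mathcal{D}_{2N+1}^0(\lambda)=\sum_{j=0}^N b_j(\lambda)\Delta_{n-1}^jT_n^{2N-2j+1}\in\mathcal{U}(\mathfrak{n}^-_{n+1})$, where $b_N(\lambda)=1$ and $(N-j+1)(2N-2j+3)b_{j-1}(\lambda)+j(n-3+2\lambda-4N+2j)b_j(\lambda)=0$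 for $j=1,\dots,N$. Then $D_{2N+1}(\lambda):\mathrm{Ind}_{P^{n+1}}^{G^{n+1}}(\xi_\lambda)\to\mathrm{Ind}_{P^n}^{G^n}(\xi_{\lambda-2N-1}\otimes\sigma_-)$ is $R(\mathcal{D}^0_{2N+1}(\lambda))$ followed by restriction to $G^n$. With $\beta^m$ the (injective) restriction of functions from $G^m$ to $(N^-)^m$, identified with $\mathbb{R}^{m-1}$ by $(x_1,\dots,x_{m-1})\mapsto\exp(x_1Q_1^-+x_2Q_2^-+\sum_{i=3}^{m-1}x_iY_{i-2}^-)$, set $D_{2N+1}^{\mathrm{nc}}(\lambda)=\beta^n\circ D_{2N+1}(\lambda)\circ(\beta^{n+1})^{-1}$ on the image of $\beta^{n+1}$ in $C^\infty(\mathbb{R}^n)$. As a differential operator it is $D_{2N+1}^{\mathrm{nc}}(\lambda)=\sum_{j=0}^N b_j(\lambda)(\Delta_{\mathbb{M}^{n-1}})^j\,i^*\left(\frac{\partial}{\partial x_n}\right)^{2N-2j+1}$, and by this formula it is regarded as an operator $C^\infty(\mathbb{R}^n)\to C^\infty(\mathbb{R}^{n-1})$. *)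

theory Defs
  imports
    "HOL-Analysis.Analysis"
    "HOL-Library.Landau_Symbols"
    "HOL-Computational_Algebra.Polynomial"
    "Jordan_Normal_Form.Matrix"
begin

hide_const (open) Finite_Cartesian_Product.mat Finite_Cartesian_Product.vec

section \<open>Smooth functions on Euclidean space\<close>

text \<open>
  \<open>\<real>\<^sup>d\<close> is the carrier of \<^term>\<open>Euclidean_space d\<close>, i.e. the real sequences vanishing from
  index \<open>d\<close> on; the coordinate \<open>x\<^sub>i\<close> of the usual notation is \<open>x (i - 1)\<close>. In particular
  \<^term>\<open>R_space (n - 1)\<close> is literally the hyperplane \<open>x\<^sub>n = 0\<close> of \<^term>\<open>R_space n\<close>, and \<open>x'\<close> is
  \<open>x(n - 1 := 0)\<close>.
\<close>

type_synonym point = "nat \<Rightarrow> real"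

abbreviation R_space :: "nat \<Rightarrow> point set" where
  "R_space d \<equiv> topspace (Euclidean_space d)"

definition pdv :: "nat \<Rightarrow> (point \<Rightarrow> complex) \<Rightarrow> point \<Rightarrow> complex" where
  "pdv i f x = vector_derivative (\<lambda>t. f (x(i := t))) (at (x i))"

primrec Ck :: "nat \<Rightarrow> nat \<Rightarrow> (point \<Rightarrow> complex) \<Rightarrow> bool" where
  "Ck d 0 f \<longleftrightarrow> continuous_map (Euclidean_space d) euclidean f"
| "Ck d (Suc k) f \<longleftrightarrow> continuous_map (Euclidean_space d) euclidean f \<and>
     (\<forall>i<d. (\<forall>x\<in>R_space d. (\<lambda>t. f (x(i := t))) differentiable (at (x i))) \<and> Ck d k (pdv i f))"

text \<open>
  Functions on \<open>\<real>\<^sup>d\<close> are extended by \<open>0\<close> to the ambient type, so that equality of functions on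
  \<open>\<real>\<^sup>d\<close> is equality in HOL.
\<close>

definition C_inf :: "nat \<Rightarrow> (point \<Rightarrow> complex) set" where
  "C_inf d = {f. (\<forall>x. x \<notin> R_space d \<longrightarrow> f x = 0) \<and> (\<forall>k. Ck d k f)}"

definition istar :: "nat \<Rightarrow> (point \<Rightarrow> complex) \<Rightarrow> point \<Rightarrow> complex" where
  "istar n f x = (if x \<in> R_space (n - 1) then f x else 0)"

definition Lap_M :: "nat \<Rightarrow> (point \<Rightarrow> complex) \<Rightarrow> point \<Rightarrow> complex" where
  "Lap_M d f x = - pdv 0 (pdv 0 f) x + (\<Sum>i=1..<d. pdv i (pdv i f) x)"

section \<open>The family $S_{2N+1}$\<close>

definition Lap_U :: "nat \<Rightarrow> (point \<Rightarrow> complex) \<Rightarrow> point \<Rightarrow> complex" where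
  "Lap_U n u x =
     of_real ((x (n - 1))\<^sup>2) * Lap_M (n - 1) u x
     + of_real ((x (n - 1))\<^sup>2) * pdv (n - 1) (pdv (n - 1) u) x
     - (of_nat n - 2) * of_real (x (n - 1)) * pdv (n - 1) u x"

definition partial_series ::
  "nat \<Rightarrow> complex \<Rightarrow> nat \<Rightarrow> (nat \<Rightarrow> point \<Rightarrow> complex) \<Rightarrow> point \<Rightarrow> complex" where
  "partial_series n l J c x =
     (\<Sum>j\<le>J. complex_of_real (x (n - 1)) powr (l + 2 * of_nat j) * c j (x(n - 1 := 0)))"

text \<open>
  \<open>c 0, \<dots>, c J\<close> (standing for \<open>c\<^sub>0, c\<^sub>2, \<dots>\<close>) are the first coefficients of a formal solution: the
  truncated series solves the equation up to the order of the first omitted term, pointwise in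
  \<open>x'\<close>. (The residual is a finite combination of \<open>x\<^sub>n powr (l + 2 j)\<close>, \<open>j \<le> J + 1\<close>, so this says that
  the coefficients for \<open>j \<le> J\<close> vanish.)
\<close>

definition formal_solution ::
  "nat \<Rightarrow> complex \<Rightarrow> nat \<Rightarrow> (nat \<Rightarrow> point \<Rightarrow> complex) \<Rightarrow> bool" where
  "formal_solution n l J c \<longleftrightarrow>
     (\<forall>j\<le>J. c j \<in> C_inf (n - 1)) \<and>
     (\<forall>x'\<in>R_space (n - 1).
        (\<lambda>t. - Lap_U n (partial_series n l J c) (x'(n - 1 := t))
             - l * (of_nat n - 1 - l) * partial_series n l J c (x'(n - 1 := t)))
        \<in> O[at_right 0](\<lambda>t. complex_of_real t powr (l + 2 * of_nat J + 2)))"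

text \<open>
  \<open>T_even n j l\<close> is \<open>T\<^sub>2\<^sub>j(l)\<close>. Only the equations that involve \<open>c\<^sub>0, \<dots>, c\<^sub>2\<^sub>j\<close> are used, hence the
  definition is meaningful at every \<open>l\<close> that is not a pole of the rational family \<open>T\<^sub>2\<^sub>j\<close>, and not only
  at those \<open>l\<close> for which all higher coefficients are determined as well.
\<close>

definition T_even :: "nat \<Rightarrow> nat \<Rightarrow> complex \<Rightarrow> (point \<Rightarrow> complex) \<Rightarrow> point \<Rightarrow> complex" where
  "T_even n j l c0 = (THE a. \<exists>c. formal_solution n l j c \<and> c 0 = c0 \<and> c j = a)"

definition S_odd :: "nat \<Rightarrow> nat \<Rightarrow> complex \<Rightarrow> (point \<Rightarrow> complex) \<Rightarrow> point \<Rightarrow> complex" where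
  "S_odd n N l f x =
     (\<Sum>j\<le>N. 1 / fact (2 * N + 1 - 2 * j) *
        T_even n j l (istar n ((pdv (n - 1) ^^ (2 * N + 1 - 2 * j)) f)) x)"

section \<open>The family $D_{2N+1}^{\mathrm{nc}}$\<close>

function b_coeff :: "nat \<Rightarrow> nat \<Rightarrow> complex \<Rightarrow> nat \<Rightarrow> complex" where
  "b_coeff n N l j =
     (if j \<ge> N then 1
      else - (of_nat (j + 1) * (of_nat n - 3 + 2 * l - 4 * of_nat N + 2 * of_nat (j + 1))
              / of_nat ((N - j) * (2 * (N - j) + 1))) * b_coeff n N l (j + 1))"
  by auto
termination by (relation "Wellfounded.measure (\<lambda>(n, N, l, j). N - j)") auto

declare b_coeff.simps [simp del]

lemma b_N: "b_coeff n N l N = 1"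
  by (simp add: b_coeff.simps)

lemma b_rec:
  assumes "j \<in> {1..N}"
  shows "of_nat ((N - j + 1) * (2 * N - 2 * j + 3)) * b_coeff n N l (j - 1)
     + of_nat j * (of_nat n - 3 + 2 * l - 4 * of_nat N + 2 * of_nat j) * b_coeff n N l j = 0"
proof -
  define K where "K = (N - j + 1) * (2 * N - 2 * j + 3)"
  have K: "(N - (j - 1)) * (2 * (N - (j - 1)) + 1) = K" "of_nat K \<noteq> (0 :: complex)"
  proof -
    obtain k where "N = j + k"
      using assms by (auto simp: le_iff_add)
    then show "(N - (j - 1)) * (2 * (N - (j - 1)) + 1) = K" "of_nat K \<noteq> (0 :: complex)"
      using assms by (auto simp: K_def algebra_simps simp del: of_nat_mult of_nat_add)
  qed
  have "\<not> j - 1 \<ge> N" "j - 1 + 1 = j"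
    using assms by auto
  then have "b_coeff n N l (j - 1) = - (of_nat j
      * (of_nat n - 3 + 2 * l - 4 * of_nat N + 2 * of_nat j) / of_nat K) * b_coeff n N l j"
    unfolding K(1) [symmetric] by (subst b_coeff.simps) simp
  then show ?thesis
    unfolding K_def [symmetric] using K(2) by simp
qed

definition Dnc :: "nat \<Rightarrow> nat \<Rightarrow> complex \<Rightarrow> (point \<Rightarrow> complex) \<Rightarrow> point \<Rightarrow> complex" where
  "Dnc n N l f x =
     (\<Sum>j\<le>N. b_coeff n N l j *
        (Lap_M (n - 1) ^^ j) (istar n ((pdv (n - 1) ^^ (2 * N - 2 * j + 1)) f)) x)"

section \<open>Induced representations\<close>

text \<open>
  The rest of this theory recovers \<^term>\<open>Dnc n N l\<close> from the homomorphism of induced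
  representations that defines it on the image of \<open>\<beta>\<close>; see \<open>Dnc_eq_conjugate\<close> at the end. Matrices for \<open>G\<^sup>m\<close> have size
  \<open>m + 1\<close>; the arguments of \<open>E_mat\<close> are counted from \<open>1\<close>.
\<close>

definition E_mat :: "nat \<Rightarrow> nat \<Rightarrow> nat \<Rightarrow> real mat" where
  "E_mat m a b = mat (m + 1) (m + 1) (\<lambda>(i, j). if i + 1 = a \<and> j + 1 = b then 1 else 0)"

definition G_grp :: "nat \<Rightarrow> real mat set" where
  "G_grp m = (let J = mat (m + 1) (m + 1) (\<lambda>(i, j). if i \<noteq> j then 0 else if i < 2 then - 1 else 1)
          in {g \<in> carrier_mat (m + 1) (m + 1). transpose_mat g * J * g = J})"

definition H_mat :: "nat \<Rightarrow> real mat" where "H_mat m = E_mat m 1 4 + E_mat m 4 1"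
definition H2_mat :: "nat \<Rightarrow> real mat" where "H2_mat m = E_mat m 2 3 + E_mat m 3 2"
definition Q1_minus :: "nat \<Rightarrow> real mat" where
  "Q1_minus m = - E_mat m 1 2 + E_mat m 2 1 + E_mat m 2 4 + E_mat m 4 2"
definition Q2_minus :: "nat \<Rightarrow> real mat" where
  "Q2_minus m = E_mat m 1 3 + E_mat m 3 1 + E_mat m 3 4 - E_mat m 4 3"
definition Y_minus :: "nat \<Rightarrow> nat \<Rightarrow> real mat" where
  "Y_minus m j = E_mat m (4 + j) 1 + E_mat m (4 + j) 4 + E_mat m 1 (4 + j) - E_mat m 4 (4 + j)"
definition Z_plus :: "nat \<Rightarrow> nat \<Rightarrow> real mat" where
  "Z_plus m j = E_mat m 2 (4 + j) + E_mat m 3 (4 + j) + E_mat m (4 + j) 2 - E_mat m (4 + j) 3"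
definition M_rot :: "nat \<Rightarrow> nat \<Rightarrow> nat \<Rightarrow> real mat" where
  "M_rot m i j = E_mat m (4 + i) (4 + j) - E_mat m (4 + j) (4 + i)"

inductive_set mat_span :: "nat \<Rightarrow> real mat set \<Rightarrow> real mat set" for m B where
  zero: "0\<^sub>m (m + 1) (m + 1) \<in> mat_span m B"
| add: "X \<in> B \<Longrightarrow> Y \<in> mat_span m B \<Longrightarrow> c \<cdot>\<^sub>m X + Y \<in> mat_span m B"

definition mexp :: "real mat \<Rightarrow> real mat" where
  "mexp X = mat (dim_row X) (dim_row X) (\<lambda>(i, j). \<Sum>k. (X ^\<^sub>m k) $$ (i, j) / fact k)"

text \<open>Submonoids; below the generating sets are closed under inversion.\<close>

inductive_set gen_by :: "nat \<Rightarrow> real mat set \<Rightarrow> real mat set" for m B where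
  one: "1\<^sub>m (m + 1) \<in> gen_by m B"
| mult: "g \<in> B \<Longrightarrow> h \<in> gen_by m B \<Longrightarrow> g * h \<in> gen_by m B"

definition M0_grp :: "nat \<Rightarrow> real mat set" where
  "M0_grp m = gen_by m (mexp ` mat_span m
     ({H2_mat m} \<union> Z_plus m ` {1..m - 3} \<union> (transpose_mat \<circ> Z_plus m) ` {1..m - 3}
      \<union> {M_rot m i j |i j. i \<in> {1..m - 3} \<and> j \<in> {1..m - 3}}))"

definition w_mat :: "nat \<Rightarrow> nat \<Rightarrow> real mat" where
  "w_mat m k = mat (m + 1) (m + 1) (\<lambda>(i, j). if i \<noteq> j then 0 else if i = k then - 1 else 1)"

definition M_hat :: "nat \<Rightarrow> real mat set" where
  "M_hat m = {v * g |v g. v \<in> gen_by m {w_mat m 1, w_mat m 2} \<and> g \<in> M0_grp m}"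

definition M_grp :: "nat \<Rightarrow> real mat set" where
  "M_grp m = M_hat m \<union> uminus ` M_hat m"

definition N_plus :: "nat \<Rightarrow> real mat set" where
  "N_plus m = mexp ` mat_span m (transpose_mat ` ({Q1_minus m, Q2_minus m} \<union> Y_minus m ` {1..m - 3}))"

text \<open>
  Smooth functions on \<open>G\<^sup>m\<close>, extended by \<open>0\<close>. Since \<open>G\<^sup>m\<close> is a closed submanifold of the matrix space,
  these are the restrictions of smooth functions of the matrix entries.
\<close>

definition C_inf_G :: "nat \<Rightarrow> (real mat \<Rightarrow> complex) set" where
  "C_inf_G m = {u. (\<forall>g. g \<notin> G_grp m \<longrightarrow> u g = 0) \<and>
     (\<exists>v \<in> C_inf ((m + 1)\<^sup>2). \<forall>x \<in> R_space ((m + 1)\<^sup>2).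
        let g = mat (m + 1) (m + 1) (\<lambda>(i, j). x (i * (m + 1) + j)) in g \<in> G_grp m \<longrightarrow> u g = v x)}"

text \<open>\<open>Ind(\<xi>\<^sub>l)\<close>, for the trivial character of \<open>M\<^sup>m\<close>.\<close>

definition Ind_rep :: "nat \<Rightarrow> complex \<Rightarrow> (real mat \<Rightarrow> complex) set" where
  "Ind_rep m l = {u \<in> C_inf_G m. \<forall>g \<in> G_grp m. \<forall>k \<in> M_grp m. \<forall>t. \<forall>h \<in> N_plus m.
     u (g * (k * mexp (t \<cdot>\<^sub>m H_mat m) * h)) = exp (l * of_real t) * u g}"

definition R_act :: "real mat \<Rightarrow> (real mat \<Rightarrow> complex) \<Rightarrow> real mat \<Rightarrow> complex" where
  "R_act X u g = vector_derivative (\<lambda>t. u (g * mexp (t \<cdot>\<^sub>m X))) (at 0)"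

text \<open>The action of \<open>\<Delta>\<^sub>n\<^sub>-\<^sub>1\<close> in the enveloping algebra of the Lie algebra of \<open>G\<^sup>n\<^sup>+\<^sup>1\<close>.\<close>

definition R_Delta :: "nat \<Rightarrow> (real mat \<Rightarrow> complex) \<Rightarrow> real mat \<Rightarrow> complex" where
  "R_Delta n u g =
     - R_act (Q1_minus (n + 1)) (R_act (Q1_minus (n + 1)) u) g
     + R_act (Q2_minus (n + 1)) (R_act (Q2_minus (n + 1)) u) g
     + (\<Sum>j=1..n - 3. R_act (Y_minus (n + 1) j) (R_act (Y_minus (n + 1) j) u) g)"

definition G_embed :: "real mat \<Rightarrow> real mat" where
  "G_embed g = four_block_mat g (0\<^sub>m (dim_row g) 1) (0\<^sub>m 1 (dim_col g)) (1\<^sub>m 1)"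

definition D_odd :: "nat \<Rightarrow> nat \<Rightarrow> complex \<Rightarrow> (real mat \<Rightarrow> complex) \<Rightarrow> real mat \<Rightarrow> complex" where
  "D_odd n N l u g =
     (\<Sum>j\<le>N. b_coeff n N l j *
        (R_Delta n ^^ j) ((R_act (Y_minus (n + 1) (n - 2)) ^^ (2 * N - 2 * j + 1)) u) (G_embed g))"

definition n_minus :: "nat \<Rightarrow> point \<Rightarrow> real mat" where
  "n_minus m x = mat (m + 1) (m + 1) (\<lambda>(a, b).
     x 0 * Q1_minus m $$ (a, b) + x 1 * Q2_minus m $$ (a, b)
     + (\<Sum>i=3..m - 1. x (i - 1) * Y_minus m (i - 2) $$ (a, b)))"

text \<open>Here \<^term>\<open>R_space (m - 1)\<close> is identified with \<open>(N\<^sup>-)\<^sup>m\<close>.\<close>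

definition beta :: "nat \<Rightarrow> (real mat \<Rightarrow> complex) \<Rightarrow> point \<Rightarrow> complex" where
  "beta m u x = (if x \<in> R_space (m - 1) then u (mexp (n_minus m x)) else 0)"


section \<open>The two descriptions of $D_{2N+1}^{\mathrm{nc}}$ agree\<close>

definition wv :: "point \<Rightarrow> nat \<Rightarrow> real" where
  "wv x a = (if a = 1 then x 0 else if a = 2 then x 1 else if a \<ge> 4 then x (a - 2) else 0)"

definition vv :: "point \<Rightarrow> nat \<Rightarrow> real" where
  "vv x a = (if a = 1 then - wv x a else wv x a)"

definition rv :: "nat \<Rightarrow> real" where
  "rv a = (if a = 0 then 1 else if a = 3 then - 1 else 0)"

definition sv :: "nat \<Rightarrow> real" where
  "sv a = (if a = 0 \<or> a = 3 then 1 else 0)"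

definition qf :: "nat \<Rightarrow> point \<Rightarrow> point \<Rightarrow> real" where
  "qf m x y = (\<Sum>c<m + 1. vv x c * wv y c)"

lemma E_mat_carrier [simp]: "E_mat m a b \<in> carrier_mat (m + 1) (m + 1)"
  by (simp add: E_mat_def)

lemma dim_E_mat [simp]: "dim_row (E_mat m a b) = m + 1" "dim_col (E_mat m a b) = m + 1"
  by (simp_all add: E_mat_def)

lemma E_mat_entry [simp]:
  "i < m + 1 \<Longrightarrow> j < m + 1 \<Longrightarrow> E_mat m a b $$ (i, j) = (if i + 1 = a \<and> j + 1 = b then 1 else 0)"
  by (simp add: E_mat_def)

lemma Y_minus_entry:
  assumes "a < m + 1" "b < m + 1" "3 \<le> i"
  shows "Y_minus m (i - 2) $$ (a, b) = (if a = i + 1 then sv b else 0) + (if b = i + 1 then rv a else 0)"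
  using assms by (auto simp: Y_minus_def sv_def rv_def)

lemma n_minus_entry:
  assumes x: "x \<in> R_space (m - 1)" and m: "m \<ge> 3" and ab: "a < m + 1" "b < m + 1"
  shows "n_minus m x $$ (a, b) = wv x a * sv b + rv a * vv x b"
proof -
  have "(\<Sum>i=3..m - 1. x (i - 1) * Y_minus m (i - 2) $$ (a, b))
      = (\<Sum>i=3..m - 1. (if a - 1 = i then (if a \<noteq> 0 then x (i - 1) * sv b else 0) else 0)
           + (if b - 1 = i then (if b \<noteq> 0 then x (i - 1) * rv a else 0) else 0))"
    by (intro sum.cong refl) (use ab in \<open>auto simp: Y_minus_entry distrib_left\<close>)
  also have "\<dots> = (if a \<ge> 4 then x (a - 2) * sv b else 0) + (if b \<ge> 4 then x (b - 2) * rv a else 0)"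
    using ab m by (auto simp: sum.distrib numeral_2_eq_2)
  finally have "n_minus m x $$ (a, b) = x 0 * Q1_minus m $$ (a, b) + x 1 * Q2_minus m $$ (a, b)
      + ((if a \<ge> 4 then x (a - 2) * sv b else 0) + (if b \<ge> 4 then x (b - 2) * rv a else 0))"
    using ab by (simp add: n_minus_def)
  then show ?thesis
    using ab m
    by (auto simp: Q1_minus_def Q2_minus_def wv_def vv_def rv_def sv_def)
qed

lemma sum_sv: "m \<ge> 3 \<Longrightarrow> (\<Sum>c<m + 1. sv c * f c) = f 0 + f 3"
proof -
  assume m: "m \<ge> 3"
  have "(\<Sum>c<m + 1. sv c * f c) = (\<Sum>c\<in>{0, 3}. sv c * f c)"
    by (rule sum.mono_neutral_right) (use m in \<open>auto simp: sv_def\<close>)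
  then show ?thesis by (simp add: sv_def)
qed

lemma sum_rv: "m \<ge> 3 \<Longrightarrow> (\<Sum>c<m + 1. f c * rv c) = f 0 - f 3"
proof -
  assume m: "m \<ge> 3"
  have "(\<Sum>c<m + 1. f c * rv c) = (\<Sum>c\<in>{0, 3}. f c * rv c)"
    by (rule sum.mono_neutral_right) (use m in \<open>auto simp: rv_def\<close>)
  then show ?thesis by (simp add: rv_def)
qed

lemma vec_simps [simp]: "wv x 0 = 0" "wv x 3 = 0" "vv x 0 = 0" "vv x 3 = 0"
    "rv 0 = 1" "rv 3 = - 1" "sv 0 = 1" "sv 3 = 1"
  by (simp_all add: wv_def vv_def rv_def sv_def)

lemma wv_zero [simp]: "wv (\<lambda>_. 0) a = 0" "vv (\<lambda>_. 0) a = 0"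
  by (simp_all add: wv_def vv_def)

text \<open>Covers the elements of \<open>N\<^sup>-\<close>, of its Lie algebra, and all products of these.\<close>

definition nm :: "nat \<Rightarrow> real \<Rightarrow> real \<Rightarrow> point \<Rightarrow> real mat" where
  "nm m d e x = mat (m + 1) (m + 1) (\<lambda>(a, b).
     (if a = b then d else 0) + wv x a * sv b + rv a * vv x b + e * rv a * sv b)"

lemma nm_mult:
  assumes m: "m \<ge> 3"
  shows "nm m d e x * nm m d' e' y =
     nm m (d * d') (d * e' + d' * e + qf m x y) (\<lambda>i. d' * x i + d * y i)" (is "?L = ?R")
proof (rule eq_matI)
  fix a b assume ab: "a < dim_row ?R" "b < dim_col ?R"
  then have ab: "a < m + 1" "b < m + 1" by (simp_all add: nm_def)
  define p where "p c = d' * (if c = b then 1 else 0) + wv y c * sv b + rv c * vv y b + e' * rv c * sv b" for c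
  have "?L $$ (a, b) = (\<Sum>c<m + 1.
      ((if a = c then d else 0) + wv x a * sv c + rv a * vv x c + e * rv a * sv c) * p c)"
    using ab by (simp add: nm_def scalar_prod_def p_def lessThan_atLeast0 if_distrib cong: if_cong)
  also have "\<dots> = (\<Sum>c<m + 1. (if a = c then d * p c else 0)) + (wv x a + e * rv a) * (\<Sum>c<m + 1. sv c * p c)
      + rv a * (\<Sum>c<m + 1. vv x c * p c)"
    by (simp only: sum_distrib_left sum.distrib [symmetric], intro sum.cong refl)
       (auto simp: algebra_simps)
  also have "(\<Sum>c<m + 1. (if a = c then d * p c else 0)) = d * p a"
    using ab by simp
  also have "(\<Sum>c<m + 1. sv c * p c) = p 0 + p 3"
    by (rule sum_sv [OF m])
  also have "p 0 + p 3 = d' * sv b"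
    by (auto simp: p_def sv_def)
  also have "(\<Sum>c<m + 1. vv x c * p c) = d' * (\<Sum>c<m + 1. if c = b then vv x c else 0)
      + sv b * qf m x y + (vv y b + e' * sv b) * (\<Sum>c<m + 1. vv x c * rv c)"
    unfolding qf_def p_def
    by (simp only: sum_distrib_left sum.distrib [symmetric], intro sum.cong refl)
       (auto simp: algebra_simps)
  also have "(\<Sum>c<m + 1. vv x c * rv c) = 0"
    by (subst sum_rv [OF m]) simp
  also have "(\<Sum>c<m + 1. if c = b then vv x c else 0) = vv x b"
    using ab by simp
  finally show "?L $$ (a, b) = ?R $$ (a, b)"
    using ab by (auto simp: nm_def p_def wv_def vv_def algebra_simps)
qed (simp_all add: nm_def)

lemma n_minus_nm: "x \<in> R_space (m - 1) \<Longrightarrow> m \<ge> 3 \<Longrightarrow> n_minus m x = nm m 0 0 x"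
  by (rule eq_matI) (simp_all add: nm_def n_minus_entry del: One_nat_def, simp_all add: n_minus_def)

lemma mexp_n_minus:
  assumes x: "x \<in> R_space (m - 1)" and m: "m \<ge> 3"
  shows "mexp (n_minus m x) = nm m 1 (qf m x x / 2) x"
proof -
  let ?X = "n_minus m x"
  have X: "?X = nm m 0 0 x" by (rule n_minus_nm [OF assms])
  have dim: "dim_row ?X = m + 1" "dim_col ?X = m + 1" by (simp_all add: n_minus_def)
  have one: "1\<^sub>m (m + 1) = nm m 1 0 (\<lambda>_. 0)"
    by (rule eq_matI) (auto simp: nm_def)
  have p0: "?X ^\<^sub>m 0 = nm m 1 0 (\<lambda>_. 0)" using one dim by simp
  have q0: "qf m (\<lambda>_. 0) x = 0" "qf m x (\<lambda>_. 0) = 0" for x by (simp_all add: qf_def)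
  have p1: "?X ^\<^sub>m 1 = nm m 0 0 x"
    using p0 by (simp add: X nm_mult [OF m] q0 del: pow_mat.simps(1))
  have p2: "?X ^\<^sub>m 2 = nm m 0 (qf m x x) (\<lambda>_. 0)"
    using p1 by (simp add: numeral_2_eq_2 X nm_mult [OF m] del: pow_mat.simps(1))
  have p3: "?X ^\<^sub>m (k + 3) = nm m 0 0 (\<lambda>_. 0)" for k
  proof (induction k)
    case 0
    show ?case using p2 by (simp add: numeral_3_eq_3 numeral_2_eq_2 X nm_mult [OF m] q0 del: pow_mat.simps(1))
  next
    case (Suc k)
    then have "?X ^\<^sub>m Suc (k + 3) = nm m 0 0 (\<lambda>_. 0)"
      by (simp only: pow_mat.simps) (simp add: X nm_mult [OF m] q0)
    then show ?case by simp
  qed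
  show ?thesis
  proof (rule eq_matI)
    fix a b assume "a < dim_row (nm m 1 (qf m x x / 2) x)" "b < dim_col (nm m 1 (qf m x x / 2) x)"
    then have ab: "a < m + 1" "b < m + 1" by (simp_all add: nm_def)
    have "(\<Sum>k. (?X ^\<^sub>m k) $$ (a, b) / fact k) = (\<Sum>k\<in>{0, 1, 2}. (?X ^\<^sub>m k) $$ (a, b) / fact k)"
    proof (rule suminf_finite)
      fix k :: nat assume "k \<notin> {0, 1, 2}"
      then have "k = (k - 3) + 3" by auto
      then have "?X ^\<^sub>m k = nm m 0 0 (\<lambda>_. 0)" by (metis p3)
      then show "(?X ^\<^sub>m k) $$ (a, b) / fact k = 0"
        using ab by (simp add: nm_def)
    qed simp
    also have "\<dots> = nm m 1 0 (\<lambda>_. 0) $$ (a, b) + nm m 0 0 x $$ (a, b)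
        + nm m 0 (qf m x x) (\<lambda>_. 0) $$ (a, b) / 2"
      using p0 p1 p2 by (simp del: pow_mat.simps)
    also have "\<dots> = nm m 1 (qf m x x / 2) x $$ (a, b)"
      using ab by (simp add: nm_def)
    finally show "mexp ?X $$ (a, b) = nm m 1 (qf m x x / 2) x $$ (a, b)"
      using ab dim by (simp add: mexp_def)
  qed (simp_all add: mexp_def nm_def n_minus_def)
qed

lemma mexp_n_minus_mult:
  assumes x: "x \<in> R_space (m - 1)" "y \<in> R_space (m - 1)" and m: "m \<ge> 3"
  shows "mexp (n_minus m x) * mexp (n_minus m y) = mexp (n_minus m (\<lambda>i. x i + y i))"
proof -
  have xy: "(\<lambda>i. x i + y i) \<in> R_space (m - 1)"
    using x by (simp add: topspace_Euclidean_space)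
  have "qf m (\<lambda>i. x i + y i) (\<lambda>i. x i + y i) = (\<Sum>c<m + 1. vv x c * wv x c + vv y c * wv y c + 2 * (vv x c * wv y c))"
    unfolding qf_def by (intro sum.cong refl) (auto simp: vv_def wv_def algebra_simps)
  also have "\<dots> = qf m x x + qf m y y + 2 * qf m x y"
    by (simp add: qf_def sum.distrib sum_distrib_left)
  finally show ?thesis
    using x xy m by (simp add: mexp_n_minus nm_mult add_divide_distrib algebra_simps)
qed

definition n_basis :: "nat \<Rightarrow> nat \<Rightarrow> real mat" where
  "n_basis m i = (if i = 0 then Q1_minus m else if i = 1 then Q2_minus m else Y_minus m (i - 1))"

lemma n_basis_n_minus:
  assumes "i < m - 1" "m \<ge> 3"
  shows "t \<cdot>\<^sub>m n_basis m i = n_minus m ((\<lambda>_. 0)(i := t))"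
proof (rule eq_matI)
  let ?x = "(\<lambda>_. 0)(i := t) :: point"
  fix a b assume "a < dim_row (n_minus m ?x)" "b < dim_col (n_minus m ?x)"
  then have ab: "a < m + 1" "b < m + 1" by (simp_all add: n_minus_def)
  have dim: "dim_row (n_basis m i) = m + 1" "dim_col (n_basis m i) = m + 1"
    by (simp_all add: n_basis_def Q1_minus_def Q2_minus_def Y_minus_def)
  have "(\<Sum>k=3..m - 1. ?x (k - 1) * Y_minus m (k - 2) $$ (a, b))
      = (\<Sum>k=3..m - 1. if k = i + 1 then t * Y_minus m (i - 1) $$ (a, b) else 0)"
    by (intro sum.cong refl) (auto simp: numeral_2_eq_2)
  also have "\<dots> = (if i \<ge> 2 then t * Y_minus m (i - 1) $$ (a, b) else 0)"
    using assms by auto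
  finally have "n_minus m ?x $$ (a, b) = ?x 0 * Q1_minus m $$ (a, b) + ?x 1 * Q2_minus m $$ (a, b)
      + (if i \<ge> 2 then t * Y_minus m (i - 1) $$ (a, b) else 0)"
    using ab by (simp only: n_minus_def index_mat split)
  moreover consider "i = 0" | "i = 1" | "i \<ge> 2" by linarith
  then have "t * n_basis m i $$ (a, b) = ?x 0 * Q1_minus m $$ (a, b) + ?x 1 * Q2_minus m $$ (a, b)
      + (if i \<ge> 2 then t * Y_minus m (i - 1) $$ (a, b) else 0)"
    by cases (simp_all add: n_basis_def)
  ultimately show "(t \<cdot>\<^sub>m n_basis m i) $$ (a, b) = n_minus m ?x $$ (a, b)"
    using ab dim by simp
qed (simp_all add: n_minus_def n_basis_def Q1_minus_def Q2_minus_def Y_minus_def)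

lemma beta_R_act:
  assumes i: "i < m - 1" and m: "m \<ge> 3"
  shows "beta m (R_act (n_basis m i) u) = pdv i (beta m u)"
proof
  fix x
  have upd [simplified, simp]: "x(i := t) \<in> R_space (m - 1) \<longleftrightarrow> x \<in> R_space (m - 1)" for t
    using i by (auto simp: topspace_Euclidean_space)
  show "beta m (R_act (n_basis m i) u) x = pdv i (beta m u) x"
  proof (cases "x \<in> R_space (m - 1)")
    case False
    then show ?thesis by (simp add: beta_def pdv_def)
  next
    case True
    have e: "(\<lambda>_. 0)(i := t) \<in> R_space (m - 1)" for t
      using i by (simp add: topspace_Euclidean_space)
    have a: "(\<lambda>k. x k + ((\<lambda>_. 0)(i := t)) k) = x(i := x i + t)" for t
      by auto
    have "(\<lambda>t. u (mexp (n_minus m x) * mexp (t \<cdot>\<^sub>m n_basis m i))) = (\<lambda>t. beta m u (x(i := x i + t)))"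
      using True e by (simp add: n_basis_n_minus [OF i m] mexp_n_minus_mult [OF _ _ m] a beta_def del: fun_upd_apply)
    then have "beta m (R_act (n_basis m i) u) x = vector_derivative (\<lambda>t. beta m u (x(i := x i + t))) (at 0)"
      using True by (simp add: beta_def [of m "R_act _ _"] R_act_def)
    also have "\<dots> = pdv i (beta m u) x"
    proof -
      have "((\<lambda>t. f (c + t)) has_vector_derivative D) (at 0) \<longleftrightarrow> (f has_vector_derivative D) (at c)"
        for f :: "real \<Rightarrow> complex" and c D
      proof
        have d: "((\<lambda>s. s - c) has_vector_derivative 1) (at c)"
          by (auto simp: has_real_derivative_iff_has_vector_derivative [symmetric]
            intro!: derivative_eq_intros)
        assume "((\<lambda>t. f (c + t)) has_vector_derivative D) (at 0)"
        then show "(f has_vector_derivative D) (at c)"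
          using vector_diff_chain_at [OF d, of "\<lambda>t. f (c + t)" D] by (simp add: o_def)
      next
        have d: "((\<lambda>t. c + t) has_vector_derivative 1) (at 0)"
          by (auto simp: has_real_derivative_iff_has_vector_derivative [symmetric]
            intro!: derivative_eq_intros)
        assume "(f has_vector_derivative D) (at c)"
        then show "((\<lambda>t. f (c + t)) has_vector_derivative D) (at 0)"
          using vector_diff_chain_at [OF d, of f D] by (simp add: o_def)
      qed
      from this [of "\<lambda>t. beta m u (x(i := t))" "x i"] show ?thesis
        by (simp add: pdv_def vector_derivative_def)
    qed
    finally show ?thesis .
  qed
qed

lemma beta_R_Delta:
  assumes n: "n \<ge> 3"
  shows "beta (n + 1) (R_Delta n u) = Lap_M (n - 1) (beta (n + 1) u)"
proof
  fix x
  let ?m = "n + 1"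
  let ?P = "\<lambda>i. R_act (n_basis ?m i) (R_act (n_basis ?m i) u)"
  have P: "beta ?m (?P i) = pdv i (pdv i (beta ?m u))" if "i < n" for i
    using that n by (simp add: beta_R_act)
  have "R_Delta n u g = - ?P 0 g + ?P 1 g + (\<Sum>i=2..<n - 1. ?P i g)" for g
  proof -
    have "(\<Sum>j=1..n - 3. R_act (Y_minus ?m j) (R_act (Y_minus ?m j) u) g) = (\<Sum>i=2..<n - 1. ?P i g)"
      by (rule sum.reindex_bij_witness [of _ "\<lambda>i. i - 1" "\<lambda>j. j + 1"]) (auto simp: n_basis_def)
    then show ?thesis by (simp add: R_Delta_def n_basis_def)
  qed
  then have "beta ?m (R_Delta n u) x
      = - beta ?m (?P 0) x + beta ?m (?P 1) x + (\<Sum>i=2..<n - 1. beta ?m (?P i) x)"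
    by (simp add: beta_def)
  also have "\<dots> = - pdv 0 (pdv 0 (beta ?m u)) x + pdv 1 (pdv 1 (beta ?m u)) x
      + (\<Sum>i=2..<n - 1. pdv i (pdv i (beta ?m u)) x)"
    using n P by (auto intro!: arg_cong2 [where f = "(+)"] sum.cong simp del: One_nat_def)
  also have "\<dots> = Lap_M (n - 1) (beta ?m u) x"
    using n by (simp add: Lap_M_def sum.atLeast_Suc_lessThan numeral_2_eq_2)
  finally show "beta ?m (R_Delta n u) x = Lap_M (n - 1) (beta ?m u) x" .
qed

lemma beta_embed:
  assumes n: "n \<ge> 3"
  shows "beta n (\<lambda>g. u (G_embed g)) = istar n (beta (n + 1) u)"
proof
  fix x
  show "beta n (\<lambda>g. u (G_embed g)) x = istar n (beta (n + 1) u) x"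
  proof (cases "x \<in> R_space (n - 1)")
    case True
    then have x': "x \<in> R_space (n + 1 - 1)" "wv x (n + 1) = 0" "vv x (n + 1) = 0"
      using n by (auto simp: topspace_Euclidean_space wv_def vv_def)
    then have q: "qf (n + 1) x x = qf n x x" by (simp add: qf_def)
    have "G_embed (nm n 1 (qf n x x / 2) x) = nm (n + 1) 1 (qf n x x / 2) x"
      using n x' by (intro eq_matI)
        (auto simp: G_embed_def nm_def less_Suc_eq rv_def sv_def)
    then show ?thesis
      using True x' q n by (simp add: beta_def istar_def mexp_n_minus)
  qed (simp add: beta_def istar_def)
qed

lemma istar_Lap_M:
  assumes n: "n \<ge> 2"
  shows "istar n (Lap_M (n - 1) f) = Lap_M (n - 1) (istar n f)"
proof -
  have upd [simplified]: "x(i := t) \<in> R_space (n - 1) \<longleftrightarrow> x \<in> R_space (n - 1)" if "i < n - 1" for i t x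
    using that by (auto simp: topspace_Euclidean_space)
  have p: "pdv i (istar n f) = istar n (pdv i f)" if "i < n - 1" for i f
    by (rule ext) (use that in \<open>simp add: pdv_def istar_def upd\<close>)
  show ?thesis
    using n by (intro ext) (simp add: Lap_M_def p istar_def)
qed

theorem Dnc_eq_beta:
  assumes n: "n \<ge> 3"
  shows "beta n (D_odd n N l u) = Dnc n N l (beta (n + 1) u)"
proof
  fix x
  let ?m = "n + 1"
  have 1: "beta ?m ((R_act (Y_minus ?m (n - 2)) ^^ k) v) = (pdv (n - 1) ^^ k) (beta ?m v)" for k v
  proof -
    have "Y_minus ?m (n - 2) = n_basis ?m (n - 1)"
      using n by (auto simp: n_basis_def numeral_2_eq_2)
    then show ?thesis
      using n by (induction k) (simp_all add: beta_R_act)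
  qed
  have 2: "beta ?m ((R_Delta n ^^ j) v) = (Lap_M (n - 1) ^^ j) (beta ?m v)" for j v
    using n by (induction j) (simp_all add: beta_R_Delta [simplified])
  have 3: "istar n ((Lap_M (n - 1) ^^ j) f) = (Lap_M (n - 1) ^^ j) (istar n f)" for j f
    using n by (induction j) (simp_all add: istar_Lap_M [simplified])
  have "beta n (D_odd n N l u) x = (\<Sum>j\<le>N. b_coeff n N l j * beta n (\<lambda>g.
      (R_Delta n ^^ j) ((R_act (Y_minus ?m (n - 2)) ^^ (2 * N - 2 * j + 1)) u) (G_embed g)) x)"
    by (simp add: beta_def D_odd_def)
  also have "\<dots> = Dnc n N l (beta ?m u) x"
    unfolding beta_embed [OF n] 2 1 3 Dnc_def ..
  finally show "beta n (D_odd n N l u) x = Dnc n N l (beta ?m u) x" .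
qed

corollary Dnc_eq_conjugate:
  assumes "n \<ge> 3" and "f \<in> beta (n + 1) ` Ind_rep (n + 1) l"
  shows "Dnc n N l f = beta n (D_odd n N l (inv_into (Ind_rep (n + 1) l) (beta (n + 1)) f))"
  using assms by (simp add: Dnc_eq_beta f_inv_into_f)

end

theory Submission
  imports Defs
begin

text \<open>
  Since \<open>\<Delta>\<^sub>U (x\<^sub>n\<^sup>\<mu> c) = x\<^sub>n\<^sup>\<mu>\<^sup>+\<^sup>2 \<Delta>\<^sub>M c + \<mu> (\<mu> - n + 1) x\<^sub>n\<^sup>\<mu> c\<close>, comparing the coefficients of
  \<open>x\<^sub>n\<^sup>\<lambda>\<^sup>+\<^sup>2\<^sup>j\<close> in the eigenvalue equation for \<open>\<Sum> x\<^sub>n\<^sup>\<lambda>\<^sup>+\<^sup>2\<^sup>j c\<^sub>2\<^sub>j\<close> gives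
    \<open>2 j (2 \<lambda> + 2 j - n + 1) c\<^sub>2\<^sub>j = - \<Delta>\<^sub>M c\<^sub>2\<^sub>j\<^sub>-\<^sub>2\<close>
  (\<open>formal_solution_iff_recursion\<close>). Hence \<open>T\<^sub>2\<^sub>j(\<lambda>)\<close> is an explicit scalar multiple of \<open>\<Delta>\<^sub>M\<^sup>j\<close>
  wherever the first \<open>j\<close> factors on the left do not vanish (\<open>T_even_eq\<close>), and both families are
  linear combinations of the same operators \<open>\<Delta>\<^sub>M\<^sup>j i\<^sup>* \<partial>\<^sub>n\<^sup>2\<^sup>N\<^sup>+\<^sup>1\<^sup>-\<^sup>2\<^sup>j\<close>.

  At the shifted parameter \<open>\<lambda> + n - 1 - (2N + 1)\<close> the factor \<open>2 \<lambda> + 2 j - n + 1\<close> becomes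
  \<open>n - 3 + 2 \<lambda> - 4 N + 2 j\<close>, which is the factor in the recursion of the \<open>b\<^sub>j\<close>. So the two coefficient
  sequences satisfy the same first-order recursion in \<open>j\<close> and are proportional
  (\<open>T_factor_b_coeff\<close>); as \<open>b\<^sub>N = 1\<close>, the ratio is the last coefficient on the \<open>S\<close> side. It is the
  reciprocal of \<open>\<Prod>\<^sub>i - 2 i (n - 3 + 2 \<lambda> - 4 N + 2 i)\<close>, \<open>1 \<le> i \<le> N\<close>, and the zeros of this polynomial are
  exactly the parameters at which some \<open>T\<^sub>2\<^sub>j\<close>, \<open>j \<le> N\<close>, has a pole.
\<close>

section \<open>Smooth functions\<close>

lemma R_space_upd: "i < d \<Longrightarrow> x(i := t) \<in> R_space d \<longleftrightarrow> x \<in> R_space d"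
  by (auto simp: topspace_Euclidean_space)

lemma C_inf_outside: "f \<in> C_inf d \<Longrightarrow> x \<notin> R_space d \<Longrightarrow> f x = 0"
  by (simp add: C_inf_def)

lemma C_inf_continuous: "f \<in> C_inf d \<Longrightarrow> continuous_map (Euclidean_space d) euclidean f"
  unfolding C_inf_def by (metis (mono_tags, lifting) Ck.simps(1) mem_Collect_eq)

lemma pdvI: "((\<lambda>t. f (x(i := t))) has_vector_derivative D) (at (x i)) \<Longrightarrow> pdv i f x = D"
  unfolding pdv_def by (rule vector_derivative_at)

text \<open>
  Functions in \<^term>\<open>C_inf d\<close> vanish off \<open>\<real>\<^sup>d\<close>, and moving along a coordinate \<open>i < d\<close> never enters or
  leaves \<open>\<real>\<^sup>d\<close>. So partial derivatives exist at every point of the ambient type, and the rules of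
  calculus below are equalities of functions without side conditions on the point.
\<close>

lemma C_inf_has_pdv:
  assumes f: "f \<in> C_inf d" and i: "i < d"
  shows "((\<lambda>t. f (x(i := t))) has_vector_derivative pdv i f x) (at (x i))"
proof -
  have "(\<lambda>t. f (x(i := t))) differentiable (at (x i))"
  proof (cases "x \<in> R_space d")
    case True
    have "Ck d 1 f" using f unfolding C_inf_def by blast
    then show ?thesis using True i by simp
  next
    case False
    then show ?thesis using C_inf_outside [OF f] i by (simp add: R_space_upd)
  qed
  then show ?thesis unfolding pdv_def by (simp add: vector_derivative_works)
qed

lemma C_inf_pdv:
  assumes f: "f \<in> C_inf d" and i: "i < d"
  shows "pdv i f \<in> C_inf d"
proof -
  have "pdv i f x = 0" if "x \<notin> R_space d" for x
    using that i by (auto intro!: pdvI simp: C_inf_outside [OF f] R_space_upd)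
  moreover have "Ck d k (pdv i f)" for k
  proof -
    have "Ck d (Suc k) f" using f unfolding C_inf_def by blast
    then show ?thesis using i by simp
  qed
  ultimately show ?thesis by (simp add: C_inf_def)
qed

lemma C_inf_pdv_funpow: "f \<in> C_inf d \<Longrightarrow> i < d \<Longrightarrow> (pdv i ^^ k) f \<in> C_inf d"
  by (induction k) (simp_all add: C_inf_pdv)

lemma pdv_lincomb:
  assumes "f \<in> C_inf d" "g \<in> C_inf d" "i < d"
  shows "pdv i (\<lambda>x. a * f x + b * g x) = (\<lambda>x. a * pdv i f x + b * pdv i g x)"
  by (rule ext, rule pdvI)
     (intro has_vector_derivative_add has_vector_derivative_mult_right C_inf_has_pdv [where d = d] assms)

lemma C_inf_lincomb:
  assumes "f \<in> C_inf d" "g \<in> C_inf d"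
  shows "(\<lambda>x. a * f x + b * g x) \<in> C_inf d"
proof -
  have cont: "continuous_map (Euclidean_space d) euclidean (\<lambda>x. a * f x + b * g x)"
    if "f \<in> C_inf d" "g \<in> C_inf d" for f g
    using that [THEN C_inf_continuous] by (simp add: continuous_map_atin tendsto_add tendsto_mult_left)
  have "Ck d k (\<lambda>x. a * f x + b * g x)" for k
    using assms
  proof (induction k arbitrary: f g)
    case 0
    then show ?case by (simp add: cont)
  next
    case (Suc k)
    have "(\<lambda>t. a * f (x(i := t)) + b * g (x(i := t))) differentiable (at (x i))" if "i < d" for i x
      using C_inf_has_pdv [OF Suc.prems(1) that] C_inf_has_pdv [OF Suc.prems(2) that]
      by (intro differentiable_add differentiable_mult differentiable_const differentiableI_vector)
    then show ?case
      using Suc by (simp add: cont pdv_lincomb C_inf_pdv)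
  qed
  then show ?thesis using assms by (simp add: C_inf_def)
qed

lemma C_inf_zero: "(\<lambda>_. 0) \<in> C_inf d"
proof -
  have p: "pdv i (\<lambda>_. 0) = (\<lambda>_. 0)" for i by (intro ext pdvI) simp
  have "Ck d k (\<lambda>_. 0)" for k by (induction k) (simp_all add: p)
  then show ?thesis by (simp add: C_inf_def)
qed

lemma C_inf_cmult: "f \<in> C_inf d \<Longrightarrow> (\<lambda>x. a * f x) \<in> C_inf d"
  using C_inf_lincomb [of f d f a 0] by simp

lemma C_inf_sum:
  assumes "\<And>i. i \<in> I \<Longrightarrow> f i \<in> C_inf d"
  shows "(\<lambda>x. \<Sum>i\<in>I. f i x) \<in> C_inf d"
  using assms
proof (induction I rule: infinite_finite_induct)
  case (insert i I)
  then show ?case using C_inf_lincomb [of "f i" d "\<lambda>x. \<Sum>i\<in>I. f i x" 1 1] by simp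
qed (simp_all add: C_inf_zero)

lemma pdv_cmult:
  assumes "f \<in> C_inf d" "i < d"
  shows "pdv i (\<lambda>x. a * f x) = (\<lambda>x. a * pdv i f x)"
  using pdv_lincomb [OF assms(1) assms(1) assms(2), of a 0] by simp

lemma C_inf_Lap_M:
  assumes f: "f \<in> C_inf d" and d: "0 < d"
  shows "Lap_M d f \<in> C_inf d"
proof -
  have "pdv i (pdv i f) \<in> C_inf d" if "i < d" for i
    using f that by (intro C_inf_pdv)
  then have "(\<lambda>x. - 1 * pdv 0 (pdv 0 f) x + 1 * (\<Sum>i=1..<d. pdv i (pdv i f) x)) \<in> C_inf d"
    using d by (intro C_inf_lincomb C_inf_sum) auto
  then show ?thesis by (simp add: Lap_M_def [abs_def])
qed

lemma C_inf_Lap_M_funpow: "f \<in> C_inf d \<Longrightarrow> 0 < d \<Longrightarrow> (Lap_M d ^^ k) f \<in> C_inf d"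
  by (induction k) (simp_all add: C_inf_Lap_M)

lemma Lap_M_cmult:
  assumes f: "f \<in> C_inf d" and d: "0 < d"
  shows "Lap_M d (\<lambda>x. a * f x) = (\<lambda>x. a * Lap_M d f x)"
proof -
  have "pdv i (pdv i (\<lambda>x. a * f x)) = (\<lambda>x. a * pdv i (pdv i f) x)" if "i < d" for i
    using that by (simp add: pdv_cmult [OF f] pdv_cmult [OF C_inf_pdv [OF f]])
  then show ?thesis
    using d by (intro ext) (simp add: Lap_M_def algebra_simps sum_distrib_left)
qed

lemma C_inf_istar:
  assumes f: "f \<in> C_inf n"
  shows "istar n f \<in> C_inf (n - 1)"
proof -
  have sub: "R_space (n - 1) \<subseteq> R_space n" by (auto simp: topspace_Euclidean_space)
  have cont: "continuous_map (Euclidean_space (n - 1)) euclidean (istar n g)" if "g \<in> C_inf n" for g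
  proof -
    have "Euclidean_space (n - 1) = subtopology (Euclidean_space n) (R_space (n - 1))"
      by (auto simp: Euclidean_space_def subtopology_subtopology intro!: arg_cong [where f = "subtopology _"])
    then have "continuous_map (Euclidean_space (n - 1)) euclidean g"
      by (metis C_inf_continuous [OF that] continuous_map_from_subtopology)
    then show ?thesis
      by (rule continuous_map_eq) (simp add: istar_def)
  qed
  have "Ck (n - 1) k (istar n f)" for k
    using f
  proof (induction k arbitrary: f)
    case 0
    then show ?case by (simp add: cont del: One_nat_def)
  next
    case (Suc k)
    have "(\<lambda>t. istar n f (x(i := t))) differentiable (at (x i))" if "i < n - 1" "x \<in> R_space (n - 1)" for i x
      using C_inf_has_pdv [OF Suc.prems, of i x, THEN differentiableI_vector] that
      by (simp add: istar_def R_space_upd del: One_nat_def fun_upd_apply)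
    moreover have "pdv i (istar n f) = istar n (pdv i f)" if "i < n - 1" for i
      by (rule ext) (use that in \<open>simp add: pdv_def istar_def R_space_upd\<close>)
    ultimately show ?case
      using Suc by (simp add: cont C_inf_pdv del: One_nat_def)
  qed
  then show ?thesis by (simp add: C_inf_def istar_def)
qed

section \<open>Uniqueness of asymptotic expansions at the boundary\<close>

lemma bigo_monomial_imp_zero:
  fixes d :: complex
  assumes "(\<lambda>t::real. d * of_real t ^ k) \<in> O[at_right 0](\<lambda>t. complex_of_real t ^ (k + 2))"
  shows "d = 0"
proof -
  obtain C where C: "\<forall>\<^sub>F t::real in at_right 0. norm (d * of_real t ^ k) \<le> C * norm (complex_of_real t ^ (k + 2))"
    using assms by (elim landau_o.bigE)
  have "\<forall>\<^sub>F t::real in at_right 0. norm d \<le> C * t\<^sup>2"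
    using C eventually_at_right_less [of 0]
  proof eventually_elim
    case (elim t)
    then have "t ^ k * norm d \<le> t ^ k * (C * t\<^sup>2)"
      by (simp add: norm_mult norm_power power_add power2_eq_square algebra_simps)
    then show ?case using elim(2) by simp
  qed
  moreover have "((\<lambda>t::real. C * t\<^sup>2) \<longlongrightarrow> C * 0\<^sup>2) (at_right 0)"
    by (intro tendsto_intros)
  ultimately have "norm d \<le> C * 0\<^sup>2"
    by (intro tendsto_lowerbound [where F = "at_right (0::real)"]) auto
  then show ?thesis by simp
qed

text \<open>
  The top term \<open>t\<^sup>2\<^sup>J\<^sup>+\<^sup>2\<close> is itself of the order allowed for degree \<open>J\<close>; so it can be dropped, the
  induction hypothesis removes all lower coefficients, and only a single monomial remains.
\<close>

lemma bigo_even_poly_imp_zero: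
  fixes d :: "nat \<Rightarrow> complex"
  assumes "(\<lambda>t::real. \<Sum>i\<le>J. d i * of_real t ^ (2 * i)) \<in> O[at_right 0](\<lambda>t. complex_of_real t ^ (2 * J + 2))"
  shows "\<forall>i\<le>J. d i = 0"
  using assms
proof (induction J)
  case 0
  then show ?case using bigo_monomial_imp_zero [of "d 0" 0] by simp
next
  case (Suc J)
  have t2: "(\<lambda>t. complex_of_real t ^ 2) \<in> O[at_right 0](\<lambda>_. 1::complex)"
  proof (rule bigoI [of _ 1])
    have "\<forall>\<^sub>F t::real in at_right 0. 0 < t \<and> t < 1"
      by (auto simp: eventually_at_right_field intro!: exI [of _ 1])
    then show "\<forall>\<^sub>F t::real in at_right 0. norm (complex_of_real t ^ 2) \<le> 1 * norm (1::complex)"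
      by eventually_elim (simp add: norm_power power_le_one)
  qed
  have "(\<lambda>t. complex_of_real t ^ (2 * Suc J + 2)) \<in> O[at_right 0](\<lambda>t. complex_of_real t ^ (2 * J + 2))"
  proof -
    have "2 * Suc J + 2 = (2 * J + 2) + 2" by simp
    then show ?thesis
      using landau_o.big.mult [OF landau_o.big_refl [of "\<lambda>t. complex_of_real t ^ (2 * J + 2)"] t2]
      by (simp only: power_add [of _ "2 * J + 2" 2] mult_1_right)
  qed
  with Suc.prems have "(\<lambda>t::real. \<Sum>i\<le>Suc J. d i * of_real t ^ (2 * i))
      \<in> O[at_right 0](\<lambda>t. complex_of_real t ^ (2 * J + 2))"
    by (rule landau_o.big_trans)
  moreover have "(\<lambda>t::real. d (Suc J) * of_real t ^ (2 * Suc J))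
      \<in> O[at_right 0](\<lambda>t. complex_of_real t ^ (2 * J + 2))"
    by (rule bigoI [of _ "norm (d (Suc J))"]) (simp add: norm_mult)
  ultimately have "(\<lambda>t::real. \<Sum>i\<le>J. d i * of_real t ^ (2 * i))
      \<in> O[at_right 0](\<lambda>t. complex_of_real t ^ (2 * J + 2))"
    using sum_in_bigo(2) by fastforce
  then have z: "\<forall>i\<le>J. d i = 0" by (rule Suc.IH)
  then have "(\<lambda>t::real. d (Suc J) * of_real t ^ (2 * Suc J))
      \<in> O[at_right 0](\<lambda>t. complex_of_real t ^ (2 * Suc J + 2))"
    using Suc.prems by simp
  then have "d (Suc J) = 0" by (rule bigo_monomial_imp_zero)
  with z show ?case by (auto simp: le_Suc_eq)
qed

lemma of_real_powr_shift:
  "t > 0 \<Longrightarrow> complex_of_real t powr (l + 2 * of_nat j) = of_real t powr l * of_real t ^ (2 * j)"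
  using powr_nat [of "complex_of_real t" "2 * j"] by (simp add: powr_add)

section \<open>Formal solutions and the operators $T_{2j}$\<close>

lemma pdv_tangential_partial_series:
  assumes c: "\<And>j. j \<le> J \<Longrightarrow> c j \<in> C_inf (n - 1)" and i: "i < n - 1"
  shows "pdv i (partial_series n l J c) = partial_series n l J (\<lambda>j. pdv i (c j))"
proof (rule ext, rule pdvI)
  fix x :: point
  have "((\<lambda>t. c j (x(i := t, n - 1 := 0))) has_vector_derivative pdv i (c j) (x(n - 1 := 0))) (at (x i))"
    if "j \<le> J" for j
    using C_inf_has_pdv [OF c [OF that] i, of "x(n - 1 := 0)"] i by (simp add: fun_upd_twist)
  then show "((\<lambda>t. partial_series n l J c (x(i := t))) has_vector_derivative
      partial_series n l J (\<lambda>j. pdv i (c j)) x) (at (x i))"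
    using i unfolding partial_series_def
    by (auto intro!: has_vector_derivative_sum has_vector_derivative_mult_right)
qed

lemma Lap_M_partial_series:
  assumes c: "\<And>j. j \<le> J \<Longrightarrow> c j \<in> C_inf (n - 1)" and n: "n \<ge> 2"
  shows "Lap_M (n - 1) (partial_series n l J c) = partial_series n l J (\<lambda>j. Lap_M (n - 1) (c j))"
proof
  fix x
  have *: "pdv i (pdv i (partial_series n l J c)) = partial_series n l J (\<lambda>j. pdv i (pdv i (c j)))"
    if "i < n - 1" for i
    using that by (simp add: pdv_tangential_partial_series c C_inf_pdv del: One_nat_def)
  have "Lap_M (n - 1) (partial_series n l J c) x
      = - partial_series n l J (\<lambda>j. pdv 0 (pdv 0 (c j))) x
        + (\<Sum>i=1..<n - 1. partial_series n l J (\<lambda>j. pdv i (pdv i (c j))) x)"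
    using n by (simp add: Lap_M_def *)
  also have "\<dots> = partial_series n l J (\<lambda>j. Lap_M (n - 1) (c j)) x"
    unfolding partial_series_def Lap_M_def
    by (subst sum.swap) (simp add: algebra_simps sum.distrib sum_distrib_left sum_negf sum_subtractf)
  finally show "Lap_M (n - 1) (partial_series n l J c) x = partial_series n l J (\<lambda>j. Lap_M (n - 1) (c j)) x" .
qed

lemma has_vector_derivative_sum_powr:
  fixes e a :: "nat \<Rightarrow> complex"
  assumes "t > 0"
  shows "((\<lambda>s. \<Sum>j\<le>J. complex_of_real s powr e j * a j) has_vector_derivative
    (\<Sum>j\<le>J. complex_of_real t powr (e j - 1) * (e j * a j))) (at t)"
proof -
  have "((\<lambda>s. complex_of_real s powr e j) has_vector_derivative e j * complex_of_real t powr (e j - 1)) (at t)" for j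
  proof -
    have "((\<lambda>z. z powr e j) has_field_derivative e j * complex_of_real t powr (e j - 1)) (at (complex_of_real t))"
      using assms by (intro has_field_derivative_powr) (auto simp: complex_nonpos_Reals_iff)
    then show ?thesis by (rule has_vector_derivative_real_field)
  qed
  then have "((\<lambda>s. \<Sum>j\<le>J. complex_of_real s powr e j * a j) has_vector_derivative
    (\<Sum>j\<le>J. e j * complex_of_real t powr (e j - 1) * a j)) (at t)"
    by (intro has_vector_derivative_sum has_vector_derivative_mult_left)
  then show ?thesis by (simp add: algebra_simps)
qed

lemma pdv_normal_partial_series:
  assumes "t > 0"
  shows "pdv (n - 1) (partial_series n l J c) (x(n - 1 := t)) =
    (\<Sum>j\<le>J. complex_of_real t powr (l + 2 * of_nat j - 1) * ((l + 2 * of_nat j) * c j (x(n - 1 := 0))))"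
  using has_vector_derivative_sum_powr [OF assms, of "\<lambda>j. l + 2 * of_nat j" "\<lambda>j. c j (x(n - 1 := 0))" J]
  by (intro pdvI) (simp add: partial_series_def)

lemma pdv_normal2_partial_series:
  assumes t: "t > 0"
  shows "pdv (n - 1) (pdv (n - 1) (partial_series n l J c)) (x(n - 1 := t)) =
    (\<Sum>j\<le>J. complex_of_real t powr (l + 2 * of_nat j - 1 - 1) *
      ((l + 2 * of_nat j - 1) * ((l + 2 * of_nat j) * c j (x(n - 1 := 0)))))"
proof (rule pdvI)
  have "((\<lambda>s. pdv (n - 1) (partial_series n l J c) (x(n - 1 := s))) has_vector_derivative
    (\<Sum>j\<le>J. complex_of_real t powr (l + 2 * of_nat j - 1 - 1) *
      ((l + 2 * of_nat j - 1) * ((l + 2 * of_nat j) * c j (x(n - 1 := 0)))))) (at t)"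
    \<comment> \<open>The formula for the first derivative is valid for \<open>x\<^sub>n > 0\<close> only, but this is an open condition.\<close>
    by (rule has_vector_derivative_transform_within_open [where S = "{0<..}", OF has_vector_derivative_sum_powr [OF t]])
       (use t in \<open>auto simp: pdv_normal_partial_series simp del: One_nat_def\<close>)
  then show "((\<lambda>s. pdv (n - 1) (partial_series n l J c) ((x(n - 1 := t))(n - 1 := s))) has_vector_derivative
    (\<Sum>j\<le>J. complex_of_real t powr (l + 2 * of_nat j - 1 - 1) *
      ((l + 2 * of_nat j - 1) * ((l + 2 * of_nat j) * c j (x(n - 1 := 0)))))) (at ((x(n - 1 := t)) (n - 1)))"
    by simp
qed

text \<open>
  The coefficient of \<open>x\<^sub>n\<^sup>l\<^sup>+\<^sup>2\<^sup>j\<close> in \<open>\<Delta>\<^sub>U u + l (n - 1 - l) u\<close> for the series \<open>u\<close> with coefficients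
  \<open>c\<close>: the factor of \<open>c j\<close> is
  \<open>\<mu> (\<mu> - n + 1) - l (l - n + 1) = (\<mu> - l) (\<mu> + l - n + 1)\<close> at \<open>\<mu> = l + 2 j\<close>.
\<close>

definition defect :: "nat \<Rightarrow> complex \<Rightarrow> (nat \<Rightarrow> point \<Rightarrow> complex) \<Rightarrow> nat \<Rightarrow> point \<Rightarrow> complex" where
  "defect n l c j x = 2 * of_nat j * (2 * l + 2 * of_nat j - of_nat n + 1) * c j x
     + (if j = 0 then 0 else Lap_M (n - 1) (c (j - 1)) x)"

lemma sum_shift_even_powers:
  fixes L :: "nat \<Rightarrow> 'a::comm_ring_1"
  shows "(\<Sum>j\<le>J. t ^ (2 * j) * (t\<^sup>2 * L j))
    = (\<Sum>j\<le>J. (if j = 0 then 0 else L (j - 1)) * t ^ (2 * j)) + L J * t ^ (2 * J + 2)"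
  by (induction J) (simp_all add: power2_eq_square algebra_simps)

text \<open>
  Truncation at \<open>J\<close> leaves one term that no equation cancels, namely the tangential Laplacian of
  \<^term>\<open>c J\<close>. It has exactly the order \<open>x\<^sub>n\<^sup>l\<^sup>+\<^sup>2\<^sup>J\<^sup>+\<^sup>2\<close> of the error that is tolerated in
  \<^term>\<open>formal_solution n l J c\<close>.
\<close>

lemma residual_partial_series:
  assumes c: "\<And>j. j \<le> J \<Longrightarrow> c j \<in> C_inf (n - 1)" and n: "n \<ge> 2"
    and x: "x \<in> R_space (n - 1)" and t: "t > 0"
  shows "- Lap_U n (partial_series n l J c) (x(n - 1 := t))
      - l * (of_nat n - 1 - l) * partial_series n l J c (x(n - 1 := t))
    = - (of_real t powr l * ((\<Sum>j\<le>J. defect n l c j x * of_real t ^ (2 * j))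
        + Lap_M (n - 1) (c J) x * of_real t ^ (2 * J + 2)))"
proof -
  define T where "T = complex_of_real t"
  have T: "T \<noteq> 0" using t by (simp add: T_def)
  define p where "p j = T powr l * T ^ (2 * j)" for j
  have pw: "T powr (l + 2 * of_nat j) = p j" for j
    using of_real_powr_shift [OF t] by (simp add: T_def p_def)
  have pw1: "T powr (l + 2 * of_nat j - 1) = p j / T" for j
    using T by (simp add: powr_diff pw)
  have pw2: "T powr (l + 2 * of_nat j - 1 - 1) = p j / T\<^sup>2" for j
    unfolding powr_diff pw using T by (simp add: power2_eq_square)
  have x0: "x(n - 1 := 0) = x" using x by (auto simp: topspace_Euclidean_space)
  have u: "partial_series n l J a (x(n - 1 := t)) = (\<Sum>j\<le>J. p j * a j x)" for a
    by (simp add: partial_series_def x0 [unfolded One_nat_def] T_def [symmetric] pw)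
  have u1: "pdv (n - 1) (partial_series n l J c) (x(n - 1 := t))
      = (\<Sum>j\<le>J. p j / T * ((l + 2 * of_nat j) * c j x))"
    unfolding pdv_normal_partial_series [OF t] x0 T_def [symmetric] pw1 ..
  have u2: "pdv (n - 1) (pdv (n - 1) (partial_series n l J c)) (x(n - 1 := t))
      = (\<Sum>j\<le>J. p j / T\<^sup>2 * ((l + 2 * of_nat j - 1) * ((l + 2 * of_nat j) * c j x)))"
    unfolding pdv_normal2_partial_series [OF t] x0 T_def [symmetric] pw2 ..
  have Lap: "Lap_M (n - 1) (partial_series n l J c) = partial_series n l J (\<lambda>j. Lap_M (n - 1) (c j))"
    by (rule Lap_M_partial_series) (use c n in auto)
  have "- Lap_U n (partial_series n l J c) (x(n - 1 := t))
      - l * (of_nat n - 1 - l) * partial_series n l J c (x(n - 1 := t))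
    = - (\<Sum>j\<le>J. T\<^sup>2 * (p j * Lap_M (n - 1) (c j) x)
        + T\<^sup>2 * (p j / T\<^sup>2 * ((l + 2 * of_nat j - 1) * ((l + 2 * of_nat j) * c j x)))
        - (of_nat n - 2) * T * (p j / T * ((l + 2 * of_nat j) * c j x))
        + l * (of_nat n - 1 - l) * (p j * c j x))"
    unfolding Lap_U_def Lap u u1 u2 fun_upd_same of_real_power T_def [symmetric]
      sum.distrib sum_subtractf sum_distrib_left
    by (simp only: minus_diff_eq minus_add_distrib diff_conv_add_uminus minus_minus add.assoc)
  also have "\<dots> = - (\<Sum>j\<le>J. T powr l * (2 * of_nat j * (2 * l + 2 * of_nat j - of_nat n + 1) * c j x * T ^ (2 * j)
        + T ^ (2 * j) * (T\<^sup>2 * Lap_M (n - 1) (c j) x)))"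
    using T by (intro arg_cong [where f = uminus] sum.cong refl)
       (simp add: p_def, simp add: algebra_simps power2_eq_square)
  also have "\<dots> = - (T powr l * ((\<Sum>j\<le>J. defect n l c j x * T ^ (2 * j))
        + Lap_M (n - 1) (c J) x * T ^ (2 * J + 2)))"
    by (simp only: sum_distrib_left [symmetric] sum.distrib sum_shift_even_powers defect_def
        distrib_right add.assoc)
  finally show ?thesis by (simp add: T_def)
qed

text \<open>
  The factor \<open>t powr l\<close> in the residual may oscillate, but it never vanishes for \<open>t > 0\<close> and can be
  cancelled. What remains is a polynomial in \<open>t\<close>, and uniqueness of expansions separates its
  coefficients.
\<close>

lemma formal_solution_iff_defect:
  assumes n: "n \<ge> 2" and c: "\<And>j. j \<le> J \<Longrightarrow> c j \<in> C_inf (n - 1)"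
  shows "formal_solution n l J c \<longleftrightarrow> (\<forall>j\<le>J. \<forall>x\<in>R_space (n - 1). defect n l c j x = 0)"
proof -
  let ?O = "\<lambda>t. complex_of_real t ^ (2 * J + 2)"
  have "(\<lambda>t. - Lap_U n (partial_series n l J c) (x(n - 1 := t))
        - l * (of_nat n - 1 - l) * partial_series n l J c (x(n - 1 := t)))
      \<in> O[at_right 0](\<lambda>t. complex_of_real t powr (l + 2 * of_nat J + 2))
    \<longleftrightarrow> (\<forall>j\<le>J. defect n l c j x = 0)" (is "?res \<in> _ \<longleftrightarrow> _")
    if x: "x \<in> R_space (n - 1)" for x
  proof -
    let ?sum = "\<lambda>t. \<Sum>j\<le>J. defect n l c j x * complex_of_real t ^ (2 * j)"
    let ?last = "\<lambda>t. Lap_M (n - 1) (c J) x * ?O t"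
    have pos: "\<forall>\<^sub>F t::real in at_right 0. t > 0" by (rule eventually_at_right_less)
    have last: "?last \<in> O[at_right 0](?O)" by simp
    have "?res \<in> O[at_right 0](\<lambda>t. complex_of_real t powr (l + 2 * of_nat J + 2))
      \<longleftrightarrow> (\<lambda>t. - (of_real t powr l * (?sum t + ?last t))) \<in> O[at_right 0](\<lambda>t. of_real t powr l * ?O t)"
    proof (rule landau_o.big.cong_ex)
      show "\<forall>\<^sub>F t in at_right 0. ?res t = - (of_real t powr l * (?sum t + ?last t))"
        using pos by eventually_elim (rule residual_partial_series [OF c n x])
      show "\<forall>\<^sub>F t in at_right 0. complex_of_real t powr (l + 2 * of_nat J + 2) = of_real t powr l * ?O t"
        using pos
      proof eventually_elim
        case (elim t)
        show ?case
          using of_real_powr_shift [OF elim, of l "Suc J"] by (simp add: algebra_simps)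
      qed
    qed
    also have "\<dots> \<longleftrightarrow> (\<lambda>t. ?sum t + ?last t) \<in> O[at_right 0](?O)"
    proof -
      have "\<forall>\<^sub>F t::real in at_right 0. complex_of_real t powr l \<noteq> 0"
        using pos by eventually_elim simp
      then show ?thesis
        by (subst landau_o.big.uminus_in_iff) (rule landau_o.big.mult_cancel_left [OF bigtheta_refl])
    qed
    also have "\<dots> \<longleftrightarrow> ?sum \<in> O[at_right 0](?O)"
      using sum_in_bigo(2) [OF _ last, of "\<lambda>t. ?sum t + ?last t"] sum_in_bigo(1) [OF _ last, of ?sum] by auto
    also have "\<dots> \<longleftrightarrow> (\<forall>j\<le>J. defect n l c j x = 0)"
    proof
      assume "?sum \<in> O[at_right 0](?O)"
      then show "\<forall>j\<le>J. defect n l c j x = 0" by (rule bigo_even_poly_imp_zero)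
    next
      assume "\<forall>j\<le>J. defect n l c j x = 0"
      then show "?sum \<in> O[at_right 0](?O)" by simp
    qed
    finally show ?thesis .
  qed
  then show ?thesis using c unfolding formal_solution_def by blast
qed

text \<open>
  At points outside \<open>\<real>\<^sup>n\<^sup>-\<^sup>1\<close> all terms vanish, and \<open>j = 0\<close> gives no condition because the exponent
  \<open>l\<close> is a root of the indicial equation.
\<close>

lemma formal_solution_iff_recursion:
  assumes n: "n \<ge> 2"
  shows "formal_solution n l J c \<longleftrightarrow> (\<forall>j\<le>J. c j \<in> C_inf (n - 1)) \<and>
    (\<forall>j<J. \<forall>x. 2 * of_nat (Suc j) * (2 * l + 2 * of_nat (Suc j) - of_nat n + 1) * c (Suc j) x
        = - Lap_M (n - 1) (c j) x)"
proof (cases "\<forall>j\<le>J. c j \<in> C_inf (n - 1)")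
  case False
  then show ?thesis unfolding formal_solution_def by blast
next
  case True
  have zero: "defect n l c j x = 0" if "x \<notin> R_space (n - 1)" "j \<le> J" for j x
  proof -
    have "Lap_M (n - 1) (c (j - 1)) \<in> C_inf (n - 1)" "c j \<in> C_inf (n - 1)"
      using True that n by (auto intro!: C_inf_Lap_M)
    then show ?thesis using that(1) by (simp add: defect_def C_inf_outside)
  qed
  have "formal_solution n l J c \<longleftrightarrow> (\<forall>j\<le>J. \<forall>x. defect n l c j x = 0)"
    using formal_solution_iff_defect [OF n, of J c l] True zero by blast
  also have "\<dots> \<longleftrightarrow> (\<forall>j<J. \<forall>x. defect n l c (Suc j) x = 0)"
  proof -
    have "defect n l c 0 x = 0" for x by (simp add: defect_def)
    then show ?thesis by (metis Suc_le_eq not0_implies_Suc)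
  qed
  finally show ?thesis using True by (simp add: defect_def add_eq_0_iff2 del: of_nat_Suc)
qed

text \<open>
  The scalar by which \<open>T\<^sub>2\<^sub>j(l)\<close> differs from the \<open>j\<close>-th power of the tangential Laplacian.
\<close>

definition T_factor :: "nat \<Rightarrow> complex \<Rightarrow> nat \<Rightarrow> complex" where
  "T_factor n l j = (\<Prod>i=1..j. - 1 / (2 * of_nat i * (2 * l + 2 * of_nat i - of_nat n + 1)))"

lemma T_factor_Suc:
  "T_factor n l (Suc j) =
     T_factor n l j * (- 1 / (2 * of_nat (Suc j) * (2 * l + 2 * of_nat (Suc j) - of_nat n + 1)))"
  by (simp add: T_factor_def del: of_nat_Suc)

text \<open>
  If none of the factors vanishes, the recursion has exactly one solution that starts with
  \<^term>\<open>c0\<close>, so the definite description in \<^const>\<open>T_even\<close> picks its \<open>j\<close>-th member.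
\<close>

lemma T_even_eq:
  assumes n: "n \<ge> 2" and c0: "c0 \<in> C_inf (n - 1)"
    and nz: "\<And>i. i \<in> {1..j} \<Longrightarrow> 2 * l + 2 * of_nat i - of_nat n + 1 \<noteq> 0"
  shows "T_even n j l c0 = (\<lambda>x. T_factor n l j * (Lap_M (n - 1) ^^ j) c0 x)"
proof -
  define c where "c i x = T_factor n l i * (Lap_M (n - 1) ^^ i) c0 x" for i x
  define A where "A i = 2 * of_nat i * (2 * l + 2 * of_nat i - of_nat n + 1)" for i
  have A: "A (Suc i) \<noteq> 0" if "i < j" for i
    using nz [of "Suc i"] that by (auto simp: A_def simp del: of_nat_Suc)
  have smooth: "(Lap_M (n - 1) ^^ i) c0 \<in> C_inf (n - 1)" for i
    using c0 n by (simp add: C_inf_Lap_M_funpow)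
  have c_rec: "A (Suc i) * c (Suc i) x = - Lap_M (n - 1) (c i) x" if "i < j" for i x
  proof -
    have "Lap_M (n - 1) (c i) = (\<lambda>x. T_factor n l i * (Lap_M (n - 1) ^^ Suc i) c0 x)"
      unfolding c_def [abs_def] using Lap_M_cmult [OF smooth] n by simp
    moreover have "A (Suc i) * T_factor n l (Suc i) = - T_factor n l i"
      unfolding T_factor_Suc A_def [symmetric] using A [OF that] by simp
    ultimately show ?thesis
      by (simp add: c_def mult.assoc [symmetric] del: funpow.simps)
  qed
  have c: "formal_solution n l j c \<and> c 0 = c0"
    unfolding formal_solution_iff_recursion [OF n] A_def [symmetric]
    using c_rec smooth by (auto simp: c_def [abs_def] T_factor_def C_inf_cmult)
  have unique: "c' j = c j" if c': "formal_solution n l j c'" "c' 0 = c0" for c'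
  proof -
    have "c' i = c i" if "i \<le> j" for i
      using that
    proof (induction i)
      case 0
      then show ?case using c c' by simp
    next
      case (Suc i)
      have "A (Suc i) * c' (Suc i) x = - Lap_M (n - 1) (c' i) x" for x
        using c'(1) Suc.prems unfolding formal_solution_iff_recursion [OF n] A_def [symmetric] by simp
      then show ?case
        using Suc c_rec [of i] A [of i] by (intro ext) (simp, metis mult_cancel_left)
    qed
    then show ?thesis by simp
  qed
  then have "T_even n j l c0 = c j"
    unfolding T_even_def using c by (intro the_equality) blast+
  then show ?thesis by (simp add: c_def [abs_def])
qed

section \<open>Comparison of the two families\<close>

text \<open>
  This is where the shift of the spectral parameter comes from: it turns the factor of the recursion
  for the formal solutions into that of the recursion for \<^const>\<open>b_coeff\<close>.
\<close>

lemma spectral_shift: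
  "2 * (l + of_nat n - 1 - of_nat (2 * N + 1)) + 2 * of_nat i - of_nat n + 1
     = of_nat n - 3 + 2 * l - 4 * of_nat N + (2 * of_nat i :: complex)"
  by simp

text \<open>
  Downward induction from \<open>j = N\<close>, where \<open>b\<^sub>N = 1\<close>. The factorials, with the
  \<open>2 j + 2\<close> in the denominator of \<^const>\<open>T_factor\<close>, contribute
  \<open>(2N - 2j + 1) (2N - 2j) / (2 j + 2) = (N - j) (2 (N - j) + 1) / (j + 1)\<close> to the step from \<open>j\<close> to
  \<open>j + 1\<close>, which is the rational number in the quotient \<open>b\<^sub>j\<^sub>+\<^sub>1 / b\<^sub>j\<close>. The factors must not vanish:
  at a zero of the factor with index \<open>j + 1\<close> the coefficient \<open>b\<^sub>j\<close> is \<open>0\<close> while the left-hand side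
  need not be.
\<close>

lemma T_factor_b_coeff:
  assumes "j \<le> N"
    and nz: "\<And>i. i \<in> {1..N} \<Longrightarrow> of_nat n - 3 + 2 * l - 4 * of_nat N + 2 * of_nat i \<noteq> (0 :: complex)"
  shows "T_factor n (l + of_nat n - 1 - of_nat (2 * N + 1)) j / fact (2 * N + 1 - 2 * j)
    = T_factor n (l + of_nat n - 1 - of_nat (2 * N + 1)) N * b_coeff n N l j"
  using assms(1)
proof (induction j rule: inc_induct)
  case base
  then show ?case by (simp add: b_N)
next
  case (step j)
  define K where "K = T_factor n (l + of_nat n - 1 - of_nat (2 * N + 1))"
  define a where "a = of_nat n - 3 + 2 * l - 4 * of_nat N + 2 * of_nat (Suc j)"
  have a: "a \<noteq> 0" unfolding a_def by (rule nz) (use step in auto)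
  obtain k where N: "N = j + Suc k" using step.hyps by (metis less_iff_Suc_add add_Suc_right)
  have K: "K (Suc j) = K j * (- 1 / (2 * of_nat (Suc j) * a))"
    unfolding K_def T_factor_Suc spectral_shift a_def ..
  have b: "b_coeff n N l j = - (of_nat (Suc j) * a / of_nat (Suc k * (2 * Suc k + 1))) * b_coeff n N l (Suc j)"
    using N by (subst b_coeff.simps) (simp add: a_def)
  have IH: "K (Suc j) / fact (2 * k + 1) = K N * b_coeff n N l (Suc j)"
    using step.IH N by (simp add: K_def)
  have f: "fact (2 * N + 1 - 2 * j) = (of_nat (2 * Suc k * (2 * Suc k + 1)) * fact (2 * k + 1) :: complex)"
  proof -
    have "2 * N + 1 - 2 * j = Suc (Suc (2 * k + 1))" using N by simp
    then show ?thesis by (simp only: fact_Suc) (simp add: algebra_simps)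
  qed
  have s: "of_nat (Suc j) \<noteq> (0::complex)" "of_nat (Suc k) \<noteq> (0::complex)"
    "of_nat (2 * Suc k + 1) \<noteq> (0::complex)"
    by (simp_all only: of_nat_eq_0_iff)
  have "K N * b_coeff n N l j = - (of_nat (Suc j) * a / of_nat (Suc k * (2 * Suc k + 1))) * (K (Suc j) / fact (2 * k + 1))"
    unfolding b IH by simp
  also have "\<dots> = K j / fact (2 * N + 1 - 2 * j)"
    unfolding K f of_nat_mult using a s by (simp add: divide_simps del: of_nat_Suc of_nat_add)
  finally show ?case by (simp add: K_def)
qed

lemma S_odd_eq_Dnc:
  assumes n: "n \<ge> 2" and f: "f \<in> C_inf n"
    and nz: "\<And>i. i \<in> {1..N} \<Longrightarrow> of_nat n - 3 + 2 * l - 4 * of_nat N + 2 * of_nat i \<noteq> (0 :: complex)"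
  shows "S_odd n N (l + of_nat n - 1 - of_nat (2 * N + 1)) f
    = (\<lambda>x. T_factor n (l + of_nat n - 1 - of_nat (2 * N + 1)) N * Dnc n N l f x)"
proof
  fix x
  let ?L = "l + of_nat n - 1 - of_nat (2 * N + 1)"
  let ?g = "\<lambda>j. istar n ((pdv (n - 1) ^^ (2 * N + 1 - 2 * j)) f)"
  have "T_even n j ?L (?g j) = (\<lambda>x. T_factor n ?L j * (Lap_M (n - 1) ^^ j) (?g j) x)" if "j \<le> N" for j
  proof (rule T_even_eq [OF n])
    show "?g j \<in> C_inf (n - 1)" using f n by (intro C_inf_istar C_inf_pdv_funpow) auto
    show "2 * ?L + 2 * of_nat i - of_nat n + 1 \<noteq> 0" if "i \<in> {1..j}" for i
      unfolding spectral_shift using nz [of i] that \<open>j \<le> N\<close> by auto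
  qed
  then have "S_odd n N ?L f x = (\<Sum>j\<le>N. T_factor n ?L j / fact (2 * N + 1 - 2 * j) * (Lap_M (n - 1) ^^ j) (?g j) x)"
    unfolding S_odd_def by (intro sum.cong refl) simp
  also have "\<dots> = (\<Sum>j\<le>N. T_factor n ?L N * (b_coeff n N l j * (Lap_M (n - 1) ^^ j) (?g j) x))"
    by (intro sum.cong refl) (simp only: T_factor_b_coeff [OF _ nz] atMost_iff mult.assoc)
  also have "\<dots> = T_factor n ?L N * Dnc n N l f x"
    unfolding Dnc_def sum_distrib_left by (intro sum.cong refl) (simp add: Suc_diff_le)
  finally show "S_odd n N ?L f x = T_factor n ?L N * Dnc n N l f x" .
qed

theorem theorem5:
  fixes n N :: nat
  assumes "n \<ge> 4"
  shows "\<exists>p q :: complex poly. p \<noteq> 0 \<and> q \<noteq> 0 \<and> coprime p q \<and>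
    (\<forall>l. poly q l \<noteq> 0 \<longrightarrow>
       (\<forall>f \<in> C_inf n.
          S_odd n N (l + of_nat n - 1 - of_nat (2 * N + 1)) f
          = (\<lambda>x. poly p l / poly q l * Dnc n N l f x)))"
proof -
  \<comment> \<open>With the numerator \<open>1\<close>, coprimality is automatic, and \<open>q\<close> vanishes precisely at the resonances.\<close>
  define q :: "complex poly" where
    "q = (\<Prod>i=1..N. Polynomial.smult (- 2 * of_nat i) [:of_nat n - 3 - 4 * of_nat N + 2 * of_nat i, 2:])"
  have q: "poly q l = (\<Prod>i=1..N. - 2 * of_nat i * (of_nat n - 3 + 2 * l - 4 * of_nat N + 2 * of_nat i))" for l
    unfolding q_def poly_prod by (intro prod.cong refl) (simp add: algebra_simps)
  have "T_factor n (l + of_nat n - 1 - of_nat (2 * N + 1)) N = 1 / poly q l" for l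
  proof -
    have inv: "1 / prod g {1..N} = (\<Prod>i=1..N. 1 / g i)" for g :: "nat \<Rightarrow> complex"
      by (subst prod_dividef) simp
    show ?thesis
      unfolding T_factor_def q spectral_shift inv by (intro prod.cong refl) simp
  qed
  moreover have "of_nat n - 3 + 2 * l - 4 * of_nat N + 2 * of_nat i \<noteq> (0 :: complex)"
    if "poly q l \<noteq> 0" "i \<in> {1..N}" for l i
    using that by (auto simp: q)
  ultimately have "S_odd n N (l + of_nat n - 1 - of_nat (2 * N + 1)) f
      = (\<lambda>x. poly 1 l / poly q l * Dnc n N l f x)" if "poly q l \<noteq> 0" "f \<in> C_inf n" for l f
    using S_odd_eq_Dnc [of n f N l] that assms by simp
  moreover have "q \<noteq> 0" unfolding q_def by auto
  ultimately show ?thesis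
    by (intro exI [of _ 1] exI [of _ q]) auto
qed

end
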